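(* Let $\mathbf{A}\in\mathbb{C}^{M\times N_a}$ and $\mathbf{B}\in\mathbb{C}^{M\times N_b}$ have unit-$\ell_2$-norm columns, let $\mathbf{D}=[\mathbf{A}\ \mathbf{B}]$, with coherence parameters $\mu_a,\mu_b,\mu_m$ and $\mu_d=\max\{\mu_a,\mu_b,\mu_m\}$, and assume $\mu_b\le\mu_a$. Let $\mathbf{z}=\mathbf{D}\mathbf{w}+\mathbf{n}$ with $\mathbf{w}=[\mathbf{x}^T\ \mathbf{e}^T]^T\in\mathbb{C}^{N_a+N_b}$ and $\|\mathbf{n}\|_2\le\varepsilon$. Let $w\ge1$ be an integer and $\mathcal{W}=\mathrm{supp}_w(\mathbf{w})$. If $$w<\max\left\{\frac{2(1+\mu_a)}{\mu_a+2\mu_d+\sqrt{\mu_a^2+\mu_m^2}},\ \frac{1+\mu_d}{2\mu_d}\right\},$$ then for any $\eta\ge\varepsilon$ every solution $\hat{\mathbf{w}}$ of $$\text{minimize }\|\tilde{\mathbf{w}}\|_1\ \text{ subject to }\ \|\mathbf{z}-\mathbf{D}\tilde{\mathbf{w}}\|_2\le\eta$$ satisfies $$\|\mathbf{w}-\hat{\mathbf{w}}\|_2\le C_7(\varepsilon+\eta)+C_8\|\mathbf{w}-\mathbf{w}_{\mathcal{W}}\|_1,$$ where $C_7,C_8\ge0$ depend only on $\mu_a,\mu_b,\mu_m,\mu_d$ and $w$.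
   Context: Coherence parameters: $\mu_a=\max_{k\ne\ell}|\mathbf{a}_k^H\mathbf{a}_\ell|$, $\mu_b=\max_{k\ne\ell}|\mathbf{b}_k^H\mathbf{b}_\ell|$, $\mu_m=\max_{k,\ell}|\mathbf{a}_k^H\mathbf{b}_\ell|$, where $\mathbf{a}_k,\mathbf{b}_\ell$ are the columns of $\mathbf{A},\mathbf{B}$; $\mu_d$ equals the coherence $\max_{i\ne j}|\mathbf{d}_i^H\mathbf{d}_j|$ of $\mathbf{D}$. $\mathbf{w}_{\mathcal{S}}$ is $\mathbf{w}$ with entries outside $\mathcal{S}$ set to zero. $\mathrm{supp}_n(\mathbf{w})$ denotes an index set of size $n$ minimizing $\|\mathbf{w}-\mathbf{w}_{\tilde{\mathcal{W}}}\|_1$ over all index sets $\tilde{\mathcal W}$ of size $n$. *)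

theory Defs
  imports Complex_Main
begin

text \<open>Vectors in C^n are represented as functions nat => complex, only the
entries with index < n being relevant. A matrix with n columns in C^M is
represented by its columns: cols :: nat => nat => complex, where cols k i is
entry i (i < M) of column k (k < n).\<close>

definition cinner :: "nat \<Rightarrow> (nat \<Rightarrow> complex) \<Rightarrow> (nat \<Rightarrow> complex) \<Rightarrow> complex" where
  "cinner M u v = (\<Sum>i<M. cnj (u i) * v i)"

definition vnorm2 :: "nat \<Rightarrow> (nat \<Rightarrow> complex) \<Rightarrow> real" where
  "vnorm2 n u = sqrt (\<Sum>i<n. (cmod (u i))^2)"

definition vnorm1 :: "nat \<Rightarrow> (nat \<Rightarrow> complex) \<Rightarrow> real" where
  "vnorm1 n u = (\<Sum>i<n. cmod (u i))"

definition restrict_vec :: "nat set \<Rightarrow> (nat \<Rightarrow> complex) \<Rightarrow> (nat \<Rightarrow> complex)" where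
  "restrict_vec S w = (\<lambda>k. if k \<in> S then w k else 0)"

definition is_supp :: "nat \<Rightarrow> nat \<Rightarrow> (nat \<Rightarrow> complex) \<Rightarrow> nat set \<Rightarrow> bool" where
  "is_supp N n w S \<longleftrightarrow> S \<subseteq> {..<N} \<and> card S = n \<and>
     (\<forall>S'. S' \<subseteq> {..<N} \<and> card S' = n \<longrightarrow>
        vnorm1 N (\<lambda>k. w k - restrict_vec S w k) \<le> vnorm1 N (\<lambda>k. w k - restrict_vec S' w k))"

text \<open>Coherence max over k ~= l of |c_k^H c_l| (0 if there are fewer than two columns).\<close>
definition coherence :: "nat \<Rightarrow> nat \<Rightarrow> (nat \<Rightarrow> nat \<Rightarrow> complex) \<Rightarrow> real" where
  "coherence M n cols =
     Max (insert 0 {cmod (cinner M (cols k) (cols l)) | k l. k < n \<and> l < n \<and> k \<noteq> l})"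

definition mutual_coherence :: "nat \<Rightarrow> nat \<Rightarrow> nat \<Rightarrow> (nat \<Rightarrow> nat \<Rightarrow> complex) \<Rightarrow> (nat \<Rightarrow> nat \<Rightarrow> complex) \<Rightarrow> real" where
  "mutual_coherence M na nb A B =
     Max (insert 0 {cmod (cinner M (A k) (B l)) | k l. k < na \<and> l < nb})"

definition concat_cols :: "nat \<Rightarrow> (nat \<Rightarrow> nat \<Rightarrow> complex) \<Rightarrow> (nat \<Rightarrow> nat \<Rightarrow> complex) \<Rightarrow> (nat \<Rightarrow> nat \<Rightarrow> complex)" where
  "concat_cols na A B = (\<lambda>k. if k < na then A k else B (k - na))"

definition matvec :: "nat \<Rightarrow> (nat \<Rightarrow> nat \<Rightarrow> complex) \<Rightarrow> (nat \<Rightarrow> complex) \<Rightarrow> (nat \<Rightarrow> complex)" where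
  "matvec n cols w = (\<lambda>i. \<Sum>k<n. cols k i * w k)"

definition is_bpdn_solution :: "nat \<Rightarrow> nat \<Rightarrow> (nat \<Rightarrow> nat \<Rightarrow> complex) \<Rightarrow> (nat \<Rightarrow> complex) \<Rightarrow> real \<Rightarrow> (nat \<Rightarrow> complex) \<Rightarrow> bool" where
  "is_bpdn_solution M n D z eta what \<longleftrightarrow>
     vnorm2 M (\<lambda>i. z i - matvec n D what i) \<le> eta \<and>
     (\<forall>w'. vnorm2 M (\<lambda>i. z i - matvec n D w' i) \<le> eta \<longrightarrow> vnorm1 n what \<le> vnorm1 n w')"

end

theory Submission
  imports Defs "HOL-Analysis.L2_Norm" "HOL-Analysis.Convex"
begin

text \<open>Write \<open>v\<close> for the minimizer, and put \<open>h = w - v\<close> and \<open>t = \<epsilon> + \<eta>\<close>. Minimality of \<open>v\<close> gives the cone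
condition: the \<open>l1\<close>-norm of \<open>h\<close> off \<open>W\<close> is at most its \<open>l1\<close>-norm on \<open>W\<close> plus \<open>2 \<sigma>\<close>, where \<open>\<sigma>\<close> is the
\<open>l1\<close>-norm of \<open>w\<close> off \<open>W\<close>. Feasibility of \<open>w\<close> and \<open>v\<close> gives \<open>\<parallel>D h\<parallel> \<le> t\<close>. Pairing \<open>D h\<close> with the columns
of \<open>D\<close> indexed by \<open>W\<close> and bounding the off-diagonal entries of the Gram matrix yields
\<open>(1 - \<delta> - s \<mu>d) p \<le> sqrt s (t + 2 \<mu>d \<sigma>)\<close> for the \<open>l2\<close>-norm \<open>p\<close> of \<open>h\<close> on \<open>W\<close>, where \<open>\<delta>\<close> bounds the
off-diagonal quadratic form on \<open>s\<close>-sparse vectors; the cone condition then controls the rest of \<open>h\<close>.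
One may take \<open>\<delta> = (s - 1) \<mu>d\<close>, or, splitting \<open>W\<close> into its \<open>A\<close>- and \<open>B\<close>-parts of sizes \<open>i\<close> and \<open>j\<close>,
\<open>\<delta> = s (\<mu>a + sqrt (\<mu>a^2 + \<mu>m^2)) / 2 - \<mu>a\<close>, because \<open>s (\<mu>a + sqrt (\<mu>a^2 + \<mu>m^2)) / 2\<close> dominates both
eigenvalues of the 2 by 2 matrix with diagonal \<open>(\<mu>a i, \<mu>a j)\<close> and off-diagonal entry \<open>\<mu>m sqrt (i j)\<close>.
The two terms of the threshold say exactly that \<open>1 - \<delta> - s \<mu>d > 0\<close> for one of these choices.\<close>

section \<open>Norms, inner products and the matrix-vector product\<close>

lemma vnorm2_L2_set: "vnorm2 n u = L2_set (\<lambda>i. cmod (u i)) {..<n}"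
  by (simp add: vnorm2_def L2_set_def)

lemma vnorm2_nonneg: "0 \<le> vnorm2 n u"
  by (simp add: vnorm2_L2_set)

lemma vnorm2_cong: "(\<And>i. i < n \<Longrightarrow> u i = v i) \<Longrightarrow> vnorm2 n u = vnorm2 n v"
  by (simp add: vnorm2_def)

lemma vnorm2_diff_le: "vnorm2 n (\<lambda>i. u i - v i) \<le> vnorm2 n u + vnorm2 n v"
proof -
  have "vnorm2 n (\<lambda>i. u i - v i) \<le> L2_set (\<lambda>i. cmod (u i) + cmod (v i)) {..<n}"
    unfolding vnorm2_L2_set by (rule L2_set_mono) (auto simp: norm_triangle_ineq4)
  also have "\<dots> \<le> vnorm2 n u + vnorm2 n v"
    unfolding vnorm2_L2_set by (rule L2_set_triangle_ineq)
  finally show ?thesis .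
qed

lemma cmod_cinner_le: "cmod (cinner M u v) \<le> vnorm2 M u * vnorm2 M v"
proof -
  have "cmod (cinner M u v) \<le> (\<Sum>i<M. \<bar>cmod (u i)\<bar> * \<bar>cmod (v i)\<bar>)"
    unfolding cinner_def by (rule order_trans[OF norm_sum]) (simp add: norm_mult)
  also have "\<dots> \<le> vnorm2 M u * vnorm2 M v"
    unfolding vnorm2_L2_set by (rule L2_set_mult_ineq)
  finally show ?thesis .
qed

lemma cinner_self: "cinner M u u = complex_of_real ((vnorm2 M u)\<^sup>2)"
  unfolding cinner_def vnorm2_def
  by (simp add: sum_nonneg complex_norm_square mult.commute flip: of_real_power)

lemma cmod_cinner_commute: "cmod (cinner M u v) = cmod (cinner M v u)"
proof -
  have "cinner M u v = cnj (cinner M v u)"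
    by (simp add: cinner_def mult.commute)
  then show ?thesis by simp
qed

lemma cinner_matvec: "cinner M u (matvec N D h) = (\<Sum>l<N. cinner M u (D l) * h l)"
proof -
  have "cinner M u (matvec N D h) = (\<Sum>i<M. \<Sum>l<N. cnj (u i) * D l i * h l)"
    by (simp add: cinner_def matvec_def sum_distrib_left mult.assoc)
  also have "\<dots> = (\<Sum>l<N. \<Sum>i<M. cnj (u i) * D l i * h l)"
    by (rule sum.swap)
  also have "\<dots> = (\<Sum>l<N. cinner M u (D l) * h l)"
    by (simp add: cinner_def sum_distrib_right)
  finally show ?thesis .
qed

lemma matvec_diff: "matvec N D (\<lambda>k. u k - v k) i = matvec N D u i - matvec N D v i"
  by (simp add: matvec_def right_diff_distrib sum_subtractf)

section \<open>Bounds on off-diagonal quadratic forms\<close>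

lemma sum_offdiag:
  fixes a :: "'i \<Rightarrow> real"
  assumes "finite S"
  shows "(\<Sum>k\<in>S. \<Sum>l\<in>S - {k}. a k * a l * c k l)
    = (\<Sum>k\<in>S. \<Sum>l\<in>S. a k * a l * c k l) - (\<Sum>k\<in>S. (a k)\<^sup>2 * c k k)"
proof -
  have "(\<Sum>l\<in>S - {k}. a k * a l * c k l) = (\<Sum>l\<in>S. a k * a l * c k l) - (a k)\<^sup>2 * c k k" if "k \<in> S" for k
    using sum_diff1[OF assms, of "\<lambda>l. a k * a l * c k l" k] that by (simp add: power2_eq_square)
  then show ?thesis by (simp add: sum_subtractf)
qed

text \<open>Once every entry is raised to \<mu>, the full double sum is \<mu> times a squared
  l1-norm. Cauchy-Schwarz bounds that by \<open>card S\<close> times the squared l2-norm, and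
  removing the diagonal lowers \<open>card S\<close> by one.\<close>

lemma offdiag_le_uniform:
  fixes a :: "'i \<Rightarrow> real"
  assumes "finite S" "\<And>k. 0 \<le> a k" "0 \<le> \<mu>"
    and g: "\<And>k l. k \<in> S \<Longrightarrow> l \<in> S \<Longrightarrow> k \<noteq> l \<Longrightarrow> g k l \<le> \<mu>"
  shows "(\<Sum>k\<in>S. \<Sum>l\<in>S - {k}. a k * a l * g k l) \<le> (real (card S) - 1) * \<mu> * (\<Sum>k\<in>S. (a k)\<^sup>2)"
proof -
  have "(\<Sum>k\<in>S. \<Sum>l\<in>S - {k}. a k * a l * g k l) \<le> (\<Sum>k\<in>S. \<Sum>l\<in>S - {k}. a k * a l * \<mu>)"
    using g assms(2) by (intro sum_mono mult_left_mono) auto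
  also have "\<dots> = \<mu> * ((\<Sum>k\<in>S. a k)\<^sup>2 - (\<Sum>k\<in>S. (a k)\<^sup>2))"
    unfolding sum_offdiag[OF assms(1), where c = "\<lambda>_ _. \<mu>"] power2_eq_square[of "sum a S"]
    by (simp add: sum_product sum_distrib_left right_diff_distrib mult_ac)
  also have "\<dots> \<le> \<mu> * (real (card S) * (\<Sum>k\<in>S. (a k)\<^sup>2) - (\<Sum>k\<in>S. (a k)\<^sup>2))"
    using sum_squared_le_sum_of_squares[of a S] assms(3)
    by (intro mult_left_mono) (auto simp: mult.commute)
  finally show ?thesis by (simp add: algebra_simps)
qed

text \<open>Here \<open>p\<close>, \<open>q\<close> stand for block sizes, \<open>P\<close>,
  \<open>Q\<close> for the l1-norms of the blocks and \<open>x\<close>, \<open>y\<close> for their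
  squared l2-norms, so \<open>P\<close> and \<open>Q\<close> are constrained by Cauchy-Schwarz. The
  bound holds because the gap between the scalar matrix and the 2 by 2 block matrix has nonnegative
  diagonal and determinant.\<close>

lemma two_block_form_le:
  fixes p q x y P Q \<mu> \<nu> :: real
  assumes "0 \<le> p" "0 \<le> q" "0 \<le> x" "0 \<le> y" "0 \<le> \<mu>" "0 \<le> P" "0 \<le> Q"
    and P: "P\<^sup>2 \<le> p * x" and Q: "Q\<^sup>2 \<le> q * y"
  shows "\<mu> * (P\<^sup>2 + Q\<^sup>2) + 2 * \<nu> * P * Q \<le> (p + q) * (\<mu> + sqrt (\<mu>\<^sup>2 + \<nu>\<^sup>2)) / 2 * (x + y)"
proof -
  define r where "r = sqrt (\<mu>\<^sup>2 + \<nu>\<^sup>2)"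
  have r2: "r\<^sup>2 = \<mu>\<^sup>2 + \<nu>\<^sup>2" and r: "\<mu> \<le> r" and r0: "0 \<le> r"
    by (auto simp: r_def intro!: real_le_rsqrt)
  \<comment> \<open>The diagonal of that gap. The entries are half of \<open>(p + q) * r\<close>
    minus or plus \<open>\<mu> * (p - q)\<close>, so their product is a difference of
    squares.\<close>
  define \<alpha> where "\<alpha> = (p + q) * (\<mu> + r) / 2 - \<mu> * p"
  define \<beta> where "\<beta> = (p + q) * (\<mu> + r) / 2 - \<mu> * q"
  have pr: "\<mu> * p \<le> r * p" "\<mu> * q \<le> r * q" "0 \<le> \<mu> * p" "0 \<le> \<mu> * q" "0 \<le> r * p" "0 \<le> r * q"
    using assms r r0 by (auto intro: mult_right_mono)
  have \<alpha>: "0 \<le> \<alpha>" and \<beta>: "0 \<le> \<beta>"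
    unfolding \<alpha>_def \<beta>_def using pr by (auto simp: algebra_simps)
  have "4 * (\<alpha> * \<beta>) = (p + q)\<^sup>2 * r\<^sup>2 - \<mu>\<^sup>2 * (p - q)\<^sup>2"
    unfolding \<alpha>_def \<beta>_def by (simp add: field_simps power2_eq_square)
  also have "\<dots> = 4 * (\<nu>\<^sup>2 * (p * q)) + \<nu>\<^sup>2 * (p - q)\<^sup>2 + 4 * (\<mu>\<^sup>2 * (p * q))"
    unfolding r2 by (simp add: algebra_simps power2_eq_square)
  also have "\<dots> \<ge> 4 * (\<nu>\<^sup>2 * (p * q))"
    using assms by simp
  finally have \<alpha>\<beta>: "\<nu>\<^sup>2 * (p * q) \<le> \<alpha> * \<beta>" by simp
  have "(2 * \<nu> * P * Q)\<^sup>2 = 4 * \<nu>\<^sup>2 * (P\<^sup>2 * Q\<^sup>2)"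
    by (simp add: power_mult_distrib)
  also have "\<dots> \<le> 4 * \<nu>\<^sup>2 * ((p * x) * (q * y))"
    using P Q assms by (intro mult_left_mono mult_mono) auto
  also have "\<dots> = 4 * (\<nu>\<^sup>2 * (p * q)) * (x * y)" by simp
  also have "\<dots> \<le> 4 * (\<alpha> * \<beta>) * (x * y)"
    using \<alpha>\<beta> assms by (intro mult_right_mono) auto
  \<comment> \<open>The inequality of arithmetic and geometric means.\<close>
  also have "\<dots> \<le> (\<alpha> * x + \<beta> * y)\<^sup>2"
    using zero_le_power2[of "\<alpha> * x - \<beta> * y"] by (simp add: power2_eq_square algebra_simps)
  finally have "2 * \<nu> * P * Q \<le> \<alpha> * x + \<beta> * y"
    by (rule power2_le_imp_le) (use \<alpha> \<beta> assms in auto)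
  moreover have "\<mu> * (P\<^sup>2 + Q\<^sup>2) \<le> \<mu> * (p * x + q * y)"
    using P Q assms by (intro mult_left_mono) auto
  ultimately show ?thesis
    unfolding r_def[symmetric] \<alpha>_def \<beta>_def by argo
qed

text \<open>The set \<open>T\<close> will be the indices of the columns of \<open>A\<close>. The
  worst-case entries \<open>c\<close> are constant on blocks, so their form depends only on the
  l1-norms \<open>P\<close> and \<open>Q\<close> of the two parts; the omitted diagonal accounts for
  the final \<open>- \<mu>\<close>.\<close>

lemma offdiag_le_two_block:
  fixes a :: "'i \<Rightarrow> real"
  assumes "finite S" "\<And>k. 0 \<le> a k" "0 \<le> \<mu>"
    and g1: "\<And>k l. k \<in> S \<Longrightarrow> l \<in> S \<Longrightarrow> k \<noteq> l \<Longrightarrow> k \<in> T \<longleftrightarrow> l \<in> T \<Longrightarrow> g k l \<le> \<mu>"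
    and g2: "\<And>k l. k \<in> S \<Longrightarrow> l \<in> S \<Longrightarrow> \<not> (k \<in> T \<longleftrightarrow> l \<in> T) \<Longrightarrow> g k l \<le> \<nu>"
  shows "(\<Sum>k\<in>S. \<Sum>l\<in>S - {k}. a k * a l * g k l)
    \<le> (real (card S) * (\<mu> + sqrt (\<mu>\<^sup>2 + \<nu>\<^sup>2)) / 2 - \<mu>) * (\<Sum>k\<in>S. (a k)\<^sup>2)"
proof -
  define c where "c k l = (if k \<in> T \<longleftrightarrow> l \<in> T then \<mu> else \<nu>)" for k l
  define P where "P = sum a (S \<inter> T)"
  define Q where "Q = sum a (S - T)"
  define x where "x = (\<Sum>k\<in>S \<inter> T. (a k)\<^sup>2)"
  define y where "y = (\<Sum>k\<in>S - T. (a k)\<^sup>2)"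
  have split: "sum f S = sum f (S \<inter> T) + sum f (S - T)" for f :: "'i \<Rightarrow> real"
    by (rule sum.Int_Diff[OF assms(1)])
  have row: "(\<Sum>l\<in>S. a k * a l * c k l) = a k * (if k \<in> T then \<mu> * P + \<nu> * Q else \<nu> * P + \<mu> * Q)" for k
    unfolding split[of "\<lambda>l. a k * a l * c k l"] P_def Q_def
    by (simp add: c_def sum_distrib_left algebra_simps)
  have "(\<Sum>k\<in>S. \<Sum>l\<in>S. a k * a l * c k l) = P * (\<mu> * P + \<nu> * Q) + Q * (\<nu> * P + \<mu> * Q)"
    unfolding row split[of "\<lambda>k. a k * _ k"] P_def Q_def
    by (simp flip: sum_distrib_right)
  then have full: "(\<Sum>k\<in>S. \<Sum>l\<in>S. a k * a l * c k l) = \<mu> * (P\<^sup>2 + Q\<^sup>2) + 2 * \<nu> * P * Q"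
    by (simp add: power2_eq_square algebra_simps)
  have card: "real (card (S \<inter> T)) + real (card (S - T)) = real (card S)"
    using split[of "\<lambda>_. 1"] by simp
  have "(\<Sum>k\<in>S. \<Sum>l\<in>S - {k}. a k * a l * g k l) \<le> (\<Sum>k\<in>S. \<Sum>l\<in>S - {k}. a k * a l * c k l)"
    using g1 g2 assms(2) by (intro sum_mono mult_left_mono) (auto simp: c_def)
  also have "\<dots> = \<mu> * (P\<^sup>2 + Q\<^sup>2) + 2 * \<nu> * P * Q - \<mu> * (x + y)"
    unfolding sum_offdiag[OF assms(1)] full x_def y_def split[symmetric]
    by (simp add: c_def sum_distrib_left mult.commute)
  also have "\<dots> \<le> real (card S) * (\<mu> + sqrt (\<mu>\<^sup>2 + \<nu>\<^sup>2)) / 2 * (x + y) - \<mu> * (x + y)"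
    unfolding card[symmetric]
    by (intro diff_right_mono two_block_form_le)
      (auto simp: P_def Q_def x_def y_def assms(2,3) sum_nonneg
        sum_squared_le_sum_of_squares mult.commute[of "real _"])
  also have "x + y = (\<Sum>k\<in>S. (a k)\<^sup>2)"
    unfolding x_def y_def split[symmetric] ..
  finally show ?thesis by (simp add: algebra_simps)
qed

section \<open>Error bound for a minimizer, given a bound on the off-diagonal form\<close>

text \<open>Unit columns put \<open>h k\<close> itself into the inner product of column
  \<open>k\<close> with \<open>D h\<close>. Solving for it, taking moduli, multiplying by
  \<open>cmod (h k)\<close> and summing over \<open>W\<close> gives the estimate.\<close>

lemma gram_estimate:
  assumes unit: "\<And>k. k < N \<Longrightarrow> vnorm2 M (D k) = 1"
    and coh: "\<And>k l. k < N \<Longrightarrow> l < N \<Longrightarrow> k \<noteq> l \<Longrightarrow> cmod (cinner M (D k) (D l)) \<le> \<mu>"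
    and W: "W \<subseteq> {..<N}"
  shows "(\<Sum>k\<in>W. (cmod (h k))\<^sup>2)
    \<le> (\<Sum>k\<in>W. \<Sum>l\<in>W - {k}. cmod (h k) * cmod (h l) * cmod (cinner M (D k) (D l)))
      + (\<Sum>k\<in>W. cmod (h k)) * (\<mu> * (\<Sum>l\<in>{..<N} - W. cmod (h l)) + vnorm2 M (matvec N D h))"
proof -
  let ?g = "\<lambda>k l. cmod (cinner M (D k) (D l))"
  have "(cmod (h k))\<^sup>2 \<le> (\<Sum>l\<in>W - {k}. cmod (h k) * cmod (h l) * ?g k l)
      + cmod (h k) * (\<mu> * (\<Sum>l\<in>{..<N} - W. cmod (h l)) + vnorm2 M (matvec N D h))"
    if k: "k \<in> W" for k
  proof -
    have kN: "k < N" using k W by auto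
    have fin: "finite W" using W finite_subset by auto
    have "cinner M (D k) (matvec N D h)
        = h k + (\<Sum>l\<in>W - {k}. cinner M (D k) (D l) * h l) + (\<Sum>l\<in>{..<N} - W. cinner M (D k) (D l) * h l)"
    proof -
      have "cinner M (D k) (matvec N D h)
          = (\<Sum>l\<in>W. cinner M (D k) (D l) * h l) + (\<Sum>l\<in>{..<N} - W. cinner M (D k) (D l) * h l)"
        unfolding cinner_matvec using sum.subset_diff[OF W, of "\<lambda>l. cinner M (D k) (D l) * h l"]
        by (simp add: add.commute)
      also have "(\<Sum>l\<in>W. cinner M (D k) (D l) * h l) = h k + (\<Sum>l\<in>W - {k}. cinner M (D k) (D l) * h l)"
        using sum.remove[OF fin k, of "\<lambda>l. cinner M (D k) (D l) * h l"]
        by (simp add: cinner_self unit[OF kN])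
      finally show ?thesis .
    qed
    then have "h k = cinner M (D k) (matvec N D h) - (\<Sum>l\<in>W - {k}. cinner M (D k) (D l) * h l)
        - (\<Sum>l\<in>{..<N} - W. cinner M (D k) (D l) * h l)"
      by simp
    then have "cmod (h k) \<le> cmod (cinner M (D k) (matvec N D h))
        + cmod (\<Sum>l\<in>W - {k}. cinner M (D k) (D l) * h l) + cmod (\<Sum>l\<in>{..<N} - W. cinner M (D k) (D l) * h l)"
      by (smt (verit) norm_triangle_ineq4)
    also have "cmod (cinner M (D k) (matvec N D h)) \<le> vnorm2 M (matvec N D h)"
      using cmod_cinner_le[of M "D k" "matvec N D h"] by (simp add: unit[OF kN])
    also have "cmod (\<Sum>l\<in>W - {k}. cinner M (D k) (D l) * h l) \<le> (\<Sum>l\<in>W - {k}. cmod (h l) * ?g k l)"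
      by (rule order_trans[OF norm_sum]) (simp add: norm_mult mult.commute)
    also have "cmod (\<Sum>l\<in>{..<N} - W. cinner M (D k) (D l) * h l) \<le> (\<Sum>l\<in>{..<N} - W. \<mu> * cmod (h l))"
      using coh kN k
      by (intro order_trans[OF norm_sum] sum_mono) (auto simp: norm_mult intro!: mult_right_mono)
    finally have "cmod (h k) \<le> (\<Sum>l\<in>W - {k}. cmod (h l) * ?g k l)
        + (\<mu> * (\<Sum>l\<in>{..<N} - W. cmod (h l)) + vnorm2 M (matvec N D h))"
      by (simp add: sum_distrib_left)
    from mult_left_mono[OF this, of "cmod (h k)"] show ?thesis
      by (simp add: power2_eq_square sum_distrib_left mult.assoc algebra_simps)
  qed
  from sum_mono[OF this] show ?thesis
    by (simp add: sum.distrib sum_distrib_right)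
qed

lemma vnorm1_minus_restrict:
  assumes "W \<subseteq> {..<N}"
  shows "vnorm1 N (\<lambda>k. w k - restrict_vec W w k) = (\<Sum>k\<in>{..<N} - W. cmod (w k))"
  unfolding vnorm1_def restrict_vec_def
  by (rule sum.mono_neutral_cong_right) auto

text \<open>The triangle inequality lets \<open>v\<close> lose at most the l1-norm of
  \<open>w - v\<close> on \<open>W\<close>; as \<open>v\<close> is no longer than \<open>w\<close>
  overall, its mass off \<open>W\<close> is bounded accordingly.\<close>

lemma l1_cone:
  assumes W: "W \<subseteq> {..<N}" and le: "vnorm1 N v \<le> vnorm1 N w"
  shows "(\<Sum>k\<in>{..<N} - W. cmod (w k - v k))
    \<le> (\<Sum>k\<in>W. cmod (w k - v k)) + 2 * (\<Sum>k\<in>{..<N} - W. cmod (w k))"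
proof -
  have split: "sum f {..<N} = sum f W + sum f ({..<N} - W)" for f :: "nat \<Rightarrow> real"
    using sum.subset_diff[OF W, of f] by simp
  have "(\<Sum>k\<in>W. cmod (w k)) \<le> (\<Sum>k\<in>W. cmod (v k)) + (\<Sum>k\<in>W. cmod (w k - v k))"
    unfolding sum.distrib[symmetric] by (intro sum_mono) (smt (verit) norm_triangle_sub)
  moreover have "(\<Sum>k\<in>{..<N} - W. cmod (w k - v k))
      \<le> (\<Sum>k\<in>{..<N} - W. cmod (w k)) + (\<Sum>k\<in>{..<N} - W. cmod (v k))"
    unfolding sum.distrib[symmetric] by (intro sum_mono norm_triangle_ineq4)
  ultimately show ?thesis
    using le unfolding vnorm1_def split by simp
qed

lemma vnorm2_le_split:
  assumes W: "W \<subseteq> {..<N}"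
  shows "vnorm2 N h \<le> L2_set (\<lambda>k. cmod (h k)) W + (\<Sum>k\<in>{..<N} - W. cmod (h k))"
proof -
  have "vnorm2 N h = sqrt ((\<Sum>k\<in>W. (cmod (h k))\<^sup>2) + (\<Sum>k\<in>{..<N} - W. (cmod (h k))\<^sup>2))"
    unfolding vnorm2_def using sum.subset_diff[OF W, of "\<lambda>k. (cmod (h k))\<^sup>2"]
    by (simp add: add.commute)
  also have "\<dots> \<le> L2_set (\<lambda>k. cmod (h k)) W + L2_set (\<lambda>k. cmod (h k)) ({..<N} - W)"
    unfolding L2_set_def by (intro sqrt_add_le_add_sqrt sum_nonneg) auto
  also have "\<dots> \<le> L2_set (\<lambda>k. cmod (h k)) W + (\<Sum>k\<in>{..<N} - W. cmod (h k))"
    by (simp add: L2_set_le_sum)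
  finally show ?thesis .
qed

text \<open>Keeping \<delta> abstract lets the uniform and the two-block estimate share one
  argument.\<close>

lemma bpdn_error_bound:
  assumes unit: "\<And>k. k < N \<Longrightarrow> vnorm2 M (D k) = 1"
    and coh: "\<And>k l. k < N \<Longrightarrow> l < N \<Longrightarrow> k \<noteq> l \<Longrightarrow> cmod (cinner M (D k) (D l)) \<le> \<mu>"
    and W: "W \<subseteq> {..<N}"
    and \<mu>: "0 \<le> \<mu>"
    and offdiag: "\<And>h. (\<Sum>k\<in>W. \<Sum>l\<in>W - {k}. cmod (h k) * cmod (h l) * cmod (cinner M (D k) (D l)))
      \<le> \<delta> * (\<Sum>k\<in>W. (cmod (h k))\<^sup>2)"
    and K: "0 < 1 - \<delta> - real (card W) * \<mu>"
    and z: "\<And>i. i < M \<Longrightarrow> z i = matvec N D w i + n i"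
    and n: "vnorm2 M n \<le> \<epsilon>" and \<eta>: "\<epsilon> \<le> \<eta>"
    and sol: "is_bpdn_solution M N D z \<eta> v"
  defines "C \<equiv> (1 + sqrt (card W)) * sqrt (card W) / (1 - \<delta> - real (card W) * \<mu>)"
  shows "vnorm2 N (\<lambda>k. w k - v k)
    \<le> C * (\<epsilon> + \<eta>) + (2 * \<mu> * C + 2) * vnorm1 N (\<lambda>k. w k - restrict_vec W w k)"
proof -
  define h where "h k = w k - v k" for k
  define \<sigma> where "\<sigma> = (\<Sum>k\<in>{..<N} - W. cmod (w k))"
  define t where "t = \<epsilon> + \<eta>"
  define p where "p = L2_set (\<lambda>k. cmod (h k)) W"
  define X where "X = (\<Sum>k\<in>W. cmod (h k))"
  define Y where "Y = (\<Sum>k\<in>{..<N} - W. cmod (h k))"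
  define r where "r = sqrt (card W)"
  define K where "K = 1 - \<delta> - real (card W) * \<mu>"
  have r: "0 \<le> r" "r\<^sup>2 = card W" by (auto simp: r_def)
  have p: "0 \<le> p" "(\<Sum>k\<in>W. (cmod (h k))\<^sup>2) = p\<^sup>2"
    by (auto simp: p_def L2_set_def sum_nonneg)
  have nonneg: "0 \<le> X" "0 \<le> Y" "0 \<le> \<sigma>"
    by (auto simp: X_def Y_def \<sigma>_def sum_nonneg)
  have Xp: "X \<le> r * p"
  proof (rule power2_le_imp_le)
    show "X\<^sup>2 \<le> (r * p)\<^sup>2"
      using sum_squared_le_sum_of_squares[of "\<lambda>k. cmod (h k)" W]
      by (simp add: X_def power_mult_distrib r p mult.commute)
  qed (use r p in auto)
  have wfeas: "vnorm2 M (\<lambda>i. z i - matvec N D w i) \<le> \<epsilon>"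
    using n by (subst vnorm2_cong[where v = n]) (auto simp: z)
  then have "vnorm1 N v \<le> vnorm1 N w"
    using sol \<eta> unfolding is_bpdn_solution_def by auto
  from l1_cone[OF W this] have YX: "Y \<le> X + 2 * \<sigma>"
    by (simp add: X_def Y_def \<sigma>_def h_def)
  have "vnorm2 M (matvec N D h) = vnorm2 M (\<lambda>i. (z i - matvec N D v i) - (z i - matvec N D w i))"
    unfolding h_def by (rule vnorm2_cong) (simp add: matvec_diff)
  also have "\<dots> \<le> \<eta> + \<epsilon>"
    using vnorm2_diff_le[of M "\<lambda>i. z i - matvec N D v i" "\<lambda>i. z i - matvec N D w i"] wfeas sol
    unfolding is_bpdn_solution_def by linarith
  finally have Dh: "vnorm2 M (matvec N D h) \<le> t" by (simp add: t_def)
  then have t0: "0 \<le> t" using vnorm2_nonneg order_trans by blast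
  have "p\<^sup>2 \<le> \<delta> * p\<^sup>2 + X * (\<mu> * Y + vnorm2 M (matvec N D h))"
    using gram_estimate[where D = D and h = h, OF unit coh W] offdiag[of h] unfolding X_def Y_def p by linarith
  also have "\<dots> \<le> \<delta> * p\<^sup>2 + (r * p) * (\<mu> * (r * p + 2 * \<sigma>) + t)"
    using Xp YX Dh \<mu> nonneg r p
    by (intro add_left_mono mult_mono add_mono order_refl mult_left_mono)
      (auto intro!: add_nonneg_nonneg vnorm2_nonneg)
  \<comment> \<open>As \<open>r\<^sup>2\<close> is \<open>card W\<close>, the term
    \<open>\<mu> * (r * p)\<^sup>2\<close> moves to the left and completes \<open>K\<close>.\<close>
  finally have "p * (K * p) \<le> p * (r * (t + 2 * \<mu> * \<sigma>))"
    unfolding K_def r(2)[symmetric] by (simp add: power2_eq_square algebra_simps)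
  moreover have "0 \<le> r * (t + 2 * \<mu> * \<sigma>)"
    using r t0 \<mu> nonneg by simp
  \<comment> \<open>A factor \<open>p\<close> is cancelled; for \<open>p = 0\<close> the claim is
    the nonnegativity just shown.\<close>
  ultimately have "K * p \<le> r * (t + 2 * \<mu> * \<sigma>)"
    using p(1) by (cases "p = 0") auto
  then have pK: "p \<le> r / K * (t + 2 * \<mu> * \<sigma>)"
    using K unfolding K_def[symmetric] by (simp add: field_simps)
  have "vnorm2 N h \<le> p + Y"
    unfolding p_def Y_def by (rule vnorm2_le_split[OF W])
  also have "\<dots> \<le> (1 + r) * p + 2 * \<sigma>"
    using YX Xp by (simp add: algebra_simps)
  also have "\<dots> \<le> (1 + r) * (r / K * (t + 2 * \<mu> * \<sigma>)) + 2 * \<sigma>"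
    using pK r by (intro add_right_mono mult_left_mono) auto
  also have "\<dots> = C * t + (2 * \<mu> * C + 2) * \<sigma>"
    unfolding C_def r_def[symmetric] K_def[symmetric] by (simp add: algebra_simps add_divide_distrib)
  finally show ?thesis
    unfolding h_def \<sigma>_def t_def vnorm1_minus_restrict[OF W] .
qed

section \<open>Coherence parameters as bounds on Gram entries\<close>

lemma
  assumes "coherence M n D = \<mu>"
  shows coherence_nonneg: "0 \<le> \<mu>"
    and cmod_cinner_le_coherence: "k < n \<Longrightarrow> l < n \<Longrightarrow> k \<noteq> l \<Longrightarrow> cmod (cinner M (D k) (D l)) \<le> \<mu>"
proof -
  let ?S = "{cmod (cinner M (D k) (D l)) | k l. k < n \<and> l < n \<and> k \<noteq> l}"
  have "?S \<subseteq> (\<lambda>(k, l). cmod (cinner M (D k) (D l))) ` ({..<n} \<times> {..<n})" by auto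
  then have fin: "finite (insert 0 ?S)"
    by (meson finite_SigmaI finite_imageI finite_insert finite_lessThan finite_subset)
  show "0 \<le> \<mu>"
    unfolding assms[symmetric] coherence_def by (rule Max_ge[OF fin]) simp
  show "cmod (cinner M (D k) (D l)) \<le> \<mu>" if "k < n" "l < n" "k \<noteq> l"
    unfolding assms[symmetric] coherence_def by (rule Max_ge[OF fin]) (use that in blast)
qed

lemma
  assumes "mutual_coherence M na nb A B = \<mu>"
  shows mutual_coherence_nonneg: "0 \<le> \<mu>"
    and cmod_cinner_le_mutual_coherence: "k < na \<Longrightarrow> l < nb \<Longrightarrow> cmod (cinner M (A k) (B l)) \<le> \<mu>"
proof -
  let ?S = "{cmod (cinner M (A k) (B l)) | k l. k < na \<and> l < nb}"
  have "?S \<subseteq> (\<lambda>(k, l). cmod (cinner M (A k) (B l))) ` ({..<na} \<times> {..<nb})" by auto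
  then have fin: "finite (insert 0 ?S)"
    by (meson finite_SigmaI finite_imageI finite_insert finite_lessThan finite_subset)
  show "0 \<le> \<mu>"
    unfolding assms[symmetric] mutual_coherence_def by (rule Max_ge[OF fin]) simp
  show "cmod (cinner M (A k) (B l)) \<le> \<mu>" if "k < na" "l < nb"
    unfolding assms[symmetric] mutual_coherence_def by (rule Max_ge[OF fin]) (use that in blast)
qed

section \<open>Recovery under the two-term sparsity threshold\<close>

theorem theorem4:
  fixes \<mu>a \<mu>b \<mu>m :: real and s :: nat
  defines "\<mu>d \<equiv> max \<mu>a (max \<mu>b \<mu>m)"
  assumes "s \<ge> 1"
    and "\<mu>b \<le> \<mu>a"
    and "\<mu>d = 0 \<or> real s < max (2 * (1 + \<mu>a) / (\<mu>a + 2 * \<mu>d + sqrt (\<mu>a^2 + \<mu>m^2)))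
                                    ((1 + \<mu>d) / (2 * \<mu>d))"
  shows "\<exists>C7 C8. C7 \<ge> 0 \<and> C8 \<ge> 0 \<and>
    (\<forall>M Na Nb A B w n z \<epsilon> \<eta> what W.
       M \<ge> 1 \<and> Na \<ge> 1 \<and> Nb \<ge> 1 \<and>
       (\<forall>k<Na. vnorm2 M (A k) = 1) \<and> (\<forall>k<Nb. vnorm2 M (B k) = 1) \<and>
       coherence M Na A = \<mu>a \<and> coherence M Nb B = \<mu>b \<and>
       mutual_coherence M Na Nb A B = \<mu>m \<and>
       (\<forall>i<M. z i = matvec (Na + Nb) (concat_cols Na A B) w i + n i) \<and>
       vnorm2 M n \<le> \<epsilon> \<and> \<eta> \<ge> \<epsilon> \<and>
       is_supp (Na + Nb) s w W \<and>
       is_bpdn_solution M (Na + Nb) (concat_cols Na A B) z \<eta> what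
       \<longrightarrow> vnorm2 (Na + Nb) (\<lambda>k. w k - what k)
             \<le> C7 * (\<epsilon> + \<eta>) + C8 * vnorm1 (Na + Nb) (\<lambda>k. w k - restrict_vec W w k))"
proof -
  define \<delta>1 where "\<delta>1 = real s * (\<mu>a + sqrt (\<mu>a\<^sup>2 + \<mu>m\<^sup>2)) / 2 - \<mu>a"
  define \<delta>2 where "\<delta>2 = (real s - 1) * \<mu>d"
  \<comment> \<open>The minimum makes either term of the threshold sufficient and still depends only
    on the coherence parameters and \<open>s\<close>.\<close>
  define \<delta> where "\<delta> = min \<delta>1 \<delta>2"
  define C where "C = (1 + sqrt s) * sqrt s / (1 - \<delta> - real s * \<mu>d)"
  show ?thesis
  proof (cases "0 \<le> \<mu>a \<and> 0 \<le> \<mu>b \<and> 0 \<le> \<mu>m")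
    \<comment> \<open>No matrices have a negative coherence parameter, so the claim is vacuous and
      both constants can be \<open>0\<close>.\<close>
    case False
    then show ?thesis
      by (intro exI[of _ 0]) (use coherence_nonneg mutual_coherence_nonneg in blast)
  next
    case True
    then have nonneg: "0 \<le> \<mu>a" "0 \<le> \<mu>b" "0 \<le> \<mu>m" "0 \<le> \<mu>d" by (auto simp: \<mu>d_def)
    have K: "0 < 1 - \<delta> - real s * \<mu>d"
    \<comment> \<open>For \<open>\<mu>d = 0\<close> the threshold is morally infinite, although
      division by zero yields \<open>0\<close>; here \<open>\<delta>2 = 0\<close> already makes the
      denominator at least \<open>1\<close>.\<close>
    proof (cases "\<mu>d = 0")
      case True
      then show ?thesis by (simp add: \<delta>_def \<delta>2_def min_def)
    next
      case False
      then have d: "0 < \<mu>d" using nonneg by simp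
      define r where "r = sqrt (\<mu>a\<^sup>2 + \<mu>m\<^sup>2)"
      have "0 \<le> r" by (simp add: r_def)
      then have den: "0 < \<mu>a + 2 * \<mu>d + r" using d nonneg by simp
      have "real s < 2 * (1 + \<mu>a) / (\<mu>a + 2 * \<mu>d + r) \<or> real s < (1 + \<mu>d) / (2 * \<mu>d)"
        using assms(4) False by (auto simp: r_def less_max_iff_disj)
      then have "0 < 1 - \<delta>1 - real s * \<mu>d \<or> 0 < 1 - \<delta>2 - real s * \<mu>d"
        using d den by (auto simp: \<delta>1_def \<delta>2_def r_def[symmetric] field_simps)
      then show ?thesis by (auto simp: \<delta>_def min_def)
    qed
    then have C: "0 \<le> C" by (simp add: C_def)
    show ?thesis
    proof (rule exI[of _ C], rule exI[of _ "2 * \<mu>d * C + 2"], intro conjI allI impI; (elim conjE)?)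
      fix M Na Nb :: nat and A B w n z \<epsilon> \<eta> what W
      assume unitA: "\<forall>k<Na. vnorm2 M (A k) = 1" and unitB: "\<forall>k<Nb. vnorm2 M (B k) = 1"
        and coh: "coherence M Na A = \<mu>a" "coherence M Nb B = \<mu>b" "mutual_coherence M Na Nb A B = \<mu>m"
        and z: "\<forall>i<M. z i = matvec (Na + Nb) (concat_cols Na A B) w i + n i"
        and n: "vnorm2 M n \<le> \<epsilon>" and \<eta>: "\<epsilon> \<le> \<eta>"
        and supp: "is_supp (Na + Nb) s w W"
        and sol: "is_bpdn_solution M (Na + Nb) (concat_cols Na A B) z \<eta> what"
      let ?D = "concat_cols Na A B"
      have W: "W \<subseteq> {..<Na + Nb}" "card W = s" using supp by (auto simp: is_supp_def)
      then have fin: "finite W" using finite_subset by auto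
      have unit: "vnorm2 M (?D k) = 1" if "k < Na + Nb" for k
        using unitA unitB that by (auto simp: concat_cols_def)
      \<comment> \<open>The assumption \<open>\<mu>b \<le> \<mu>a\<close> lets \<mu>a serve for both
        diagonal blocks.\<close>
      have same: "cmod (cinner M (?D k) (?D l)) \<le> \<mu>a"
        if "k < Na + Nb" "l < Na + Nb" "k \<noteq> l" "k < Na \<longleftrightarrow> l < Na" for k l
        using that cmod_cinner_le_coherence[OF coh(1), of k l]
          cmod_cinner_le_coherence[OF coh(2), of "k - Na" "l - Na"] assms(3)
        by (cases "k < Na") (fastforce simp: concat_cols_def)+
      have diff: "cmod (cinner M (?D k) (?D l)) \<le> \<mu>m"
        \<comment> \<open>The mutual coherence pairs a column of \<open>A\<close> with one of
          \<open>B\<close> in that order; conjugate symmetry covers the other order.\<close>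
        if "k < Na + Nb" "l < Na + Nb" "\<not> (k < Na \<longleftrightarrow> l < Na)" for k l
        using that cmod_cinner_le_mutual_coherence[OF coh(3), of k "l - Na"]
          cmod_cinner_le_mutual_coherence[OF coh(3), of l "k - Na"]
          cmod_cinner_commute[of M "?D k" "?D l"]
        by (auto simp: concat_cols_def split: if_splits)
      have all: "cmod (cinner M (?D k) (?D l)) \<le> \<mu>d"
        if "k < Na + Nb" "l < Na + Nb" "k \<noteq> l" for k l
        using same[of k l] diff[of k l] that by (fastforce simp: \<mu>d_def)
      have offdiag: "(\<Sum>k\<in>W. \<Sum>l\<in>W - {k}. cmod (h k) * cmod (h l) * cmod (cinner M (?D k) (?D l)))
          \<le> \<delta> * (\<Sum>k\<in>W. (cmod (h k))\<^sup>2)" for h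
      proof -
        have "(\<Sum>k\<in>W. \<Sum>l\<in>W - {k}. cmod (h k) * cmod (h l) * cmod (cinner M (?D k) (?D l)))
            \<le> \<delta>1 * (\<Sum>k\<in>W. (cmod (h k))\<^sup>2)"
          unfolding \<delta>1_def W(2)[symmetric]
          by (rule offdiag_le_two_block[where T = "{..<Na}"])
            (use fin nonneg W(1) in \<open>auto intro!: same diff\<close>)
        moreover have "(\<Sum>k\<in>W. \<Sum>l\<in>W - {k}. cmod (h k) * cmod (h l) * cmod (cinner M (?D k) (?D l)))
            \<le> \<delta>2 * (\<Sum>k\<in>W. (cmod (h k))\<^sup>2)"
          unfolding \<delta>2_def W(2)[symmetric]
          by (rule offdiag_le_uniform) (use fin nonneg W(1) all in auto)
        ultimately show ?thesis by (simp add: \<delta>_def min_def)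
      qed
      show "vnorm2 (Na + Nb) (\<lambda>k. w k - what k)
          \<le> C * (\<epsilon> + \<eta>) + (2 * \<mu>d * C + 2) * vnorm1 (Na + Nb) (\<lambda>k. w k - restrict_vec W w k)"
        using bpdn_error_bound[where D = ?D, OF unit all W(1) nonneg(4) offdiag _ _ n \<eta> sol] K z
        by (simp add: W(2) C_def)
    qed (use C nonneg in auto)
  qed
qed

end
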